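(* There is an output-polynomial-time algorithm solving \textsc{GraphMirr.Enum} on all graphs if and only if there is an output-polynomial-time algorithm solving \textsc{GraphMirr.Enum} on co-bipartite graphs.
   Context: All graphs are finite, simple and undirected. For a graph $G$ and vertex $v$, $N[v]$ denotes the closed neighborhood of $v$. For $I \subseteq V(G)$ and $x \in I$, the set of private neighbors of $x$ with respect to $I$ is $\mathsf{priv}_G(x,I) = \{y \in N[x] : N[y]\cap I = \{x\}\}$ (a vertex may be its own private neighbor). A set $I$ is irredundant if $\mathsf{priv}_G(x,I)\neq\emptyset$ for every $x\in I$, and redundant otherwise. $\mathsf{MaxIrr}(G)$ is the family of inclusion-wise maximal irredundant sets of $G$. The problem \textsc{GraphMirr.Enum} takes as input a graph $G$ and asks to list, without repetition, all members of $\mathsf{MaxIrr}(G)$. An enumeration algorithm runs in output-polynomial time if its total running time is bounded by a polynomial in the combined size of the input and the output. A graph is co-bipartite if its vertex set can be partitioned into two cliques. *)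

theory Defs
  imports "Graph_Theory.Graph_Theory" "HOL-Computational_Algebra.Polynomial"
begin

text \<open>
  Finite simple undirected graphs are the symmetric loop-free digraphs without parallel arcs
  of \<^locale>\<open>pair_graph\<close>: an edge \<open>{u, v}\<close> is the pair of arcs \<open>(u, v)\<close>, \<open>(v, u)\<close>.
\<close>

definition closed_nbhd :: "'a pair_pre_digraph \<Rightarrow> 'a \<Rightarrow> 'a set" where
  "closed_nbhd G v = insert v {u. (v, u) \<in> parcs G}"

definition priv :: "'a pair_pre_digraph \<Rightarrow> 'a \<Rightarrow> 'a set \<Rightarrow> 'a set" where
  "priv G x I = {y \<in> closed_nbhd G x. closed_nbhd G y \<inter> I = {x}}"

definition irredundant :: "'a pair_pre_digraph \<Rightarrow> 'a set \<Rightarrow> bool" where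
  "irredundant G I \<longleftrightarrow> I \<subseteq> pverts G \<and> (\<forall>x\<in>I. priv G x I \<noteq> {})"

definition MaxIrr :: "'a pair_pre_digraph \<Rightarrow> 'a set set" where
  "MaxIrr G = {I. irredundant G I \<and> (\<forall>J. irredundant G J \<and> I \<subseteq> J \<longrightarrow> J = I)}"

definition is_clique :: "'a pair_pre_digraph \<Rightarrow> 'a set \<Rightarrow> bool" where
  "is_clique G K \<longleftrightarrow> K \<subseteq> pverts G \<and> (\<forall>u\<in>K. \<forall>v\<in>K. u \<noteq> v \<longrightarrow> (u, v) \<in> parcs G)"

text \<open>One of the two cliques may be empty, so that complete graphs are co-bipartite.\<close>

definition co_bipartite :: "'a pair_pre_digraph \<Rightarrow> bool" where
  "co_bipartite G \<longleftrightarrow>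
     (\<exists>A B. A \<union> B = pverts G \<and> A \<inter> B = {} \<and> is_clique G A \<and> is_clique G B)"

text \<open>
  The model of computation is the language of while programs over binary trees (pure LISP
  data), as in Neil Jones, \<^emph>\<open>Computability and Complexity from a Programming Perspective\<close>.
  A program may only build a pair, take a pair apart, and test for the atom.
  Each of these operations costs one unit of time. This is the cost on a pointer machine: pairing
  allocates one cell and shares its arguments, so a run of length \<open>t\<close> creates at most \<open>t\<close> cells,
  and a Turing machine simulates it on the resulting acyclic graph of cells in time polynomial
  in \<open>t\<close> and the input size. Conversely a Turing machine, with its tape held as two lists, is
  simulated with constant overhead. Writing out the final tree takes time polynomial in the
  size of that graph and of the tree. Hence polynomial running time in the
  size of input and output means the same here as for Turing machines.
\<close>

datatype sexp = Atom | Dot sexp sexp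

fun left :: "sexp \<Rightarrow> sexp" where
  "left Atom = Atom"
| "left (Dot a b) = a"

fun right :: "sexp \<Rightarrow> sexp" where
  "right Atom = Atom"
| "right (Dot a b) = b"

datatype expr =
    Var nat
  | AtomE
  | PairE expr expr
  | LeftE expr
  | RightE expr

datatype prog =
    Skip
  | Assign nat expr
  | Seq prog prog
  | Cond expr prog prog
  | While expr prog

type_synonym store = "nat \<Rightarrow> sexp"

fun eval_expr :: "expr \<Rightarrow> store \<Rightarrow> sexp" where
  "eval_expr (Var x) s = s x"
| "eval_expr AtomE s = Atom"
| "eval_expr (PairE e f) s = Dot (eval_expr e s) (eval_expr f s)"
| "eval_expr (LeftE e) s = left (eval_expr e s)"
| "eval_expr (RightE e) s = right (eval_expr e s)"

fun expr_cost :: "expr \<Rightarrow> nat" where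
  "expr_cost (Var x) = 1"
| "expr_cost AtomE = 1"
| "expr_cost (PairE e f) = 1 + expr_cost e + expr_cost f"
| "expr_cost (LeftE e) = 1 + expr_cost e"
| "expr_cost (RightE e) = 1 + expr_cost e"

text \<open>
  \<open>exec c s t s'\<close>: started in store \<open>s\<close>, program \<open>c\<close> halts after time \<open>t\<close> in store \<open>s'\<close>.
  In tests, \<^const>\<open>Atom\<close> stands for false and every pair for true.
\<close>

inductive exec :: "prog \<Rightarrow> store \<Rightarrow> nat \<Rightarrow> store \<Rightarrow> bool" where
  Skip: "exec Skip s 1 s"
| Assign: "exec (Assign x e) s (1 + expr_cost e) (s(x := eval_expr e s))"
| Seq: "exec c s t s' \<Longrightarrow> exec d s' t' s'' \<Longrightarrow> exec (Seq c d) s (t + t') s''"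
| CondTrue: "eval_expr e s \<noteq> Atom \<Longrightarrow> exec c s t s' \<Longrightarrow>
    exec (Cond e c d) s (1 + expr_cost e + t) s'"
| CondFalse: "eval_expr e s = Atom \<Longrightarrow> exec d s t s' \<Longrightarrow>
    exec (Cond e c d) s (1 + expr_cost e + t) s'"
| WhileTrue: "eval_expr e s \<noteq> Atom \<Longrightarrow> exec c s t s' \<Longrightarrow> exec (While e c) s' t' s'' \<Longrightarrow>
    exec (While e c) s (1 + expr_cost e + t + t') s''"
| WhileFalse: "eval_expr e s = Atom \<Longrightarrow> exec (While e c) s (1 + expr_cost e) s"

text \<open>Variable 0 holds the input at the start and the output at the end.\<close>

definition computes :: "prog \<Rightarrow> sexp \<Rightarrow> nat \<Rightarrow> sexp \<Rightarrow> bool" where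
  "computes c inp t out \<longleftrightarrow> (\<exists>s'. exec c ((\<lambda>_. Atom)(0 := inp)) t s' \<and> s' 0 = out)"

fun enc_list :: "sexp list \<Rightarrow> sexp" where
  "enc_list [] = Atom"
| "enc_list (x # xs) = Dot x (enc_list xs)"

definition enc_bool :: "bool \<Rightarrow> sexp" where
  "enc_bool b = (if b then Dot Atom Atom else Atom)"

text \<open>
  Inputs are graphs with vertex set \<open>{0..<n}\<close>, given by their adjacency matrix. Vertex
  sets are written as characteristic vectors of length \<open>n\<close>.
\<close>

definition input_graphs :: "nat pair_pre_digraph set" where
  "input_graphs = {G. pair_graph G \<and> (\<exists>n. pverts G = {0..<n})}"

definition enc_graph :: "nat pair_pre_digraph \<Rightarrow> sexp" where
  "enc_graph G = (let n = card (pverts G) in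
     enc_list (map (\<lambda>u. enc_list (map (\<lambda>v. enc_bool ((u, v) \<in> parcs G)) [0..<n])) [0..<n]))"

definition enc_vset :: "nat pair_pre_digraph \<Rightarrow> nat set \<Rightarrow> sexp" where
  "enc_vset G I = enc_list (map (\<lambda>v. enc_bool (v \<in> I)) [0..<card (pverts G)])"

definition solves_GraphMirr_Enum :: "prog \<Rightarrow> nat pair_pre_digraph set \<Rightarrow> bool" where
  "solves_GraphMirr_Enum c \<G> \<longleftrightarrow>
     (\<forall>G\<in>\<G>. \<exists>t Is. computes c (enc_graph G) t (enc_list (map (enc_vset G) Is)) \<and>
        distinct Is \<and> set Is = MaxIrr G)"

text \<open>
  Programs are deterministic, so there is at most one \<open>t\<close> and \<open>out\<close> for each input. The
  library function \<^const>\<open>size\<close> counts the pairs in a tree.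
\<close>

definition output_polynomial_time :: "prog \<Rightarrow> nat pair_pre_digraph set \<Rightarrow> bool" where
  "output_polynomial_time c \<G> \<longleftrightarrow>
     (\<exists>p :: nat poly. \<forall>G\<in>\<G>. \<exists>t out. computes c (enc_graph G) t out \<and>
        t \<le> poly p (size (enc_graph G) + size out))"

end

theory Submission
  imports Defs
begin

text \<open>
  Given \<open>G\<close>, let \<open>K\<close> be \<open>G\<close> with two isolated vertices added: its maximal irredundant sets are those
  of \<open>G\<close> enlarged by both new vertices. Let \<open>H\<close> consist of two disjoint copies of the vertices of
  \<open>K\<close>, each made into a clique, where \<open>x\<close> in one copy is adjacent to \<open>y\<close> in the other iff
  \<open>x \<in> N[y]\<close> in \<open>K\<close>. A private neighbour of one of at least two chosen vertices within a copy lies in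
  the other copy, so irredundant sets within a copy are those of \<open>K\<close>; an irredundant set meeting both
  copies has exactly one vertex in each. Hence a maximal irredundant set of \<open>H\<close> that contains the
  first copies of both new vertices encodes a maximal irredundant set of \<open>G\<close>, each of these arises
  exactly once, and with \<open>N\<close> the number of vertices of \<open>K\<close> the graph \<open>H\<close> has at most
  \<open>2 * card (MaxIrr G) + N\<^sup>2\<close> maximal irredundant sets. So running the given program on
  \<open>H\<close> and filtering its output costs only polynomially more.
\<close>

section \<open>Irredundant sets in the doubled graph\<close>

locale cobipartite_double =
  fixes K :: "'a pair_pre_digraph" and H :: "'b pair_pre_digraph" and a b :: "'a \<Rightarrow> 'b"
  assumes nbhd_in: "x \<in> pverts K \<Longrightarrow> closed_nbhd K x \<subseteq> pverts K"
    and inj_a: "inj_on a (pverts K)" and inj_b: "inj_on b (pverts K)"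
    and disj: "a ` pverts K \<inter> b ` pverts K = {}"
    and verts: "pverts H = a ` pverts K \<union> b ` pverts K"
    and nbhd_a: "x \<in> pverts K \<Longrightarrow> closed_nbhd H (a x) = a ` pverts K \<union> b ` closed_nbhd K x"
    and nbhd_b: "x \<in> pverts K \<Longrightarrow> closed_nbhd H (b x) = b ` pverts K \<union> a ` closed_nbhd K x"
begin

lemma swap: "cobipartite_double K H b a"
  using nbhd_in inj_a inj_b disj verts nbhd_a nbhd_b
  by unfold_locales (auto simp: Int_commute Un_commute)

lemma irredundant_image_a:
  assumes I: "I \<subseteq> pverts K"
  shows "irredundant H (a ` I) \<longleftrightarrow> irredundant K I"
proof -
  have "priv H (a x) (a ` I) \<noteq> {} \<longleftrightarrow> priv K x I \<noteq> {}" if x: "x \<in> I" for x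
  proof
    assume "priv H (a x) (a ` I) \<noteq> {}"
    then obtain z where z: "z \<in> closed_nbhd H (a x)" "closed_nbhd H z \<inter> a ` I = {a x}"
      by (auto simp: priv_def)
    have xV: "x \<in> pverts K" using x I by auto
    from z(1) nbhd_a[OF xV] consider w where "w \<in> pverts K" "z = a w"
      | w where "w \<in> closed_nbhd K x" "z = b w" by auto
    then show "priv K x I \<noteq> {}"
    proof cases
      case 1
      then have "a ` I \<subseteq> {a x}" using z(2) nbhd_a[of w] I by blast
      then have "I = {x}" using inj_a I x xV by (auto dest: inj_onD)
      then have "x \<in> priv K x I" by (auto simp: priv_def closed_nbhd_def)
      then show ?thesis by blast
    next
      case 2
      then have wV: "w \<in> pverts K" using nbhd_in[OF xV] by auto
      have "a ` (closed_nbhd K w \<inter> I) = {a x}"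
        using z(2) nbhd_b[OF wV] 2 disj I inj_on_image_Int[OF inj_a nbhd_in[OF wV] I] by blast
      moreover have "closed_nbhd K w \<inter> I \<subseteq> pverts K" using I by auto
      ultimately have "closed_nbhd K w \<inter> I = {x}"
        using inj_on_image_eq_iff[OF inj_a, of "closed_nbhd K w \<inter> I" "{x}"] xV by auto
      then have "w \<in> priv K x I" using 2 by (auto simp: priv_def)
      then show ?thesis by blast
    qed
  next
    assume "priv K x I \<noteq> {}"
    then obtain w where w: "w \<in> closed_nbhd K x" "closed_nbhd K w \<inter> I = {x}"
      by (auto simp: priv_def)
    have xV: "x \<in> pverts K" using x I by auto
    have wV: "w \<in> pverts K" using w nbhd_in[OF xV] by auto
    have "closed_nbhd H (b w) \<inter> a ` I = a ` (closed_nbhd K w \<inter> I)"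
      using nbhd_b[OF wV] disj I inj_on_image_Int[OF inj_a nbhd_in[OF wV] I] by blast
    then have "b w \<in> priv H (a x) (a ` I)"
      using w nbhd_a[OF xV] by (auto simp: priv_def)
    then show "priv H (a x) (a ` I) \<noteq> {}" by blast
  qed
  then show ?thesis using I verts by (auto simp: irredundant_def)
qed

text \<open>A private neighbour of \<open>a x\<close> in the clique of \<open>b\<close> would also
  see \<open>b y\<close>. Hence it lies in the clique of \<open>a\<close>, where it sees every
  chosen vertex of that clique.\<close>

lemma irredundant_mixed_a:
  assumes J: "irredundant H J" and x: "x \<in> pverts K" "a x \<in> J" and y: "y \<in> pverts K" "b y \<in> J"
  shows "J \<inter> a ` pverts K = {a x}"
proof -
  obtain z where z: "z \<in> closed_nbhd H (a x)" "closed_nbhd H z \<inter> J = {a x}"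
    using J x by (auto simp: irredundant_def priv_def)
  have "z \<notin> b ` pverts K"
  proof
    assume "z \<in> b ` pverts K"
    then have "b y \<in> closed_nbhd H z" using nbhd_b y by auto
    then show False using z y x disj by blast
  qed
  then obtain w where "w \<in> pverts K" "z = a w"
    using z(1) nbhd_a[OF x(1)] nbhd_in[OF x(1)] by blast
  then show ?thesis using z(2) nbhd_a[of w] x by blast
qed

lemma irredundant_cases:
  assumes J: "irredundant H J"
  obtains I where "I \<subseteq> pverts K" "J = a ` I"
    | I where "I \<subseteq> pverts K" "J = b ` I"
    | x y where "x \<in> pverts K" "y \<in> pverts K" "J = {a x, b y}"
proof -
  have sub: "J \<subseteq> a ` pverts K \<union> b ` pverts K" using J verts by (auto simp: irredundant_def)
  consider "J \<inter> b ` pverts K = {}" | "J \<inter> a ` pverts K = {}"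
    | x y where "x \<in> pverts K" "a x \<in> J" "y \<in> pverts K" "b y \<in> J" by blast
  then show thesis
  proof cases
    case 1
    then have "J \<subseteq> a ` pverts K" using sub by blast
    then show thesis using that(1) by (auto simp: subset_image_iff)
  next
    case 2
    then have "J \<subseteq> b ` pverts K" using sub by blast
    then show thesis using that(2) by (auto simp: subset_image_iff)
  next
    case 3
    interpret sw: cobipartite_double K H b a by (rule swap)
    have "J \<inter> a ` pverts K = {a x}" "J \<inter> b ` pverts K = {b y}"
      using irredundant_mixed_a sw.irredundant_mixed_a J 3 by auto
    moreover have "J = (J \<inter> a ` pverts K) \<union> (J \<inter> b ` pverts K)" using sub by blast
    ultimately have "J = {a x, b y}" by (simp add: insert_commute)
    then show thesis by (rule that(3)[OF 3(1,3)])
  qed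
qed

lemma MaxIrr_image_a:
  assumes "a ` I \<in> MaxIrr H" and I: "I \<subseteq> pverts K"
  shows "I \<in> MaxIrr K"
proof -
  have "J = I" if J: "irredundant K J" "I \<subseteq> J" for J
  proof -
    have JV: "J \<subseteq> pverts K" using J by (auto simp: irredundant_def)
    then have "irredundant H (a ` J)" using irredundant_image_a J by auto
    moreover have "L = a ` I" if "irredundant H L" "a ` I \<subseteq> L" for L
      using assms(1) that unfolding MaxIrr_def by blast
    ultimately have "a ` J = a ` I" using J by (meson image_mono)
    then show ?thesis using inj_on_image_eq_iff[OF inj_a JV I] by simp
  qed
  then show ?thesis using assms irredundant_image_a[OF I] by (auto simp: MaxIrr_def)
qed

lemma image_a_MaxIrr:
  assumes I: "I \<in> MaxIrr K" and uv: "u \<in> I" "v \<in> I" "u \<noteq> v"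
  shows "a ` I \<in> MaxIrr H"
proof -
  have IV: "I \<subseteq> pverts K" using I by (auto simp: MaxIrr_def irredundant_def)
  have "J = a ` I" if J: "irredundant H J" "a ` I \<subseteq> J" for J
  proof -
    have ne: "a u \<noteq> a v" using uv IV inj_a by (auto dest: inj_onD)
    have in': "a u \<in> J" "a v \<in> J" using uv J by auto
    have nb: "a w \<notin> b ` pverts K" if "w \<in> I" for w using that IV disj by blast
    from J(1) show ?thesis
    proof (cases rule: irredundant_cases)
      case (1 J')
      then have "irredundant K J'" using irredundant_image_a J by auto
      moreover have "I \<subseteq> J'" using inj_on_image_mem_iff[OF inj_a _ 1(1)] J(2) 1(2) IV by blast
      ultimately show ?thesis using I 1 by (auto simp: MaxIrr_def)
    next
      case (2 J')
      then show ?thesis using nb uv in' by blast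
    next
      case (3 x y)
      then have "a u \<noteq> b y" "a v \<noteq> b y" using nb uv by blast+
      then show ?thesis using 3 in' ne by auto
    qed
  qed
  then show ?thesis using I irredundant_image_a[OF IV] by (auto simp: MaxIrr_def)
qed

text \<open>Two prescribed vertices of one clique exclude both the sets in the other clique and the
  mixed pairs; this is the filter applied to the enumeration for \<open>H\<close>.\<close>

lemma MaxIrr_with_two_a:
  assumes uv: "u \<in> pverts K" "v \<in> pverts K" "u \<noteq> v"
  shows "{J \<in> MaxIrr H. a u \<in> J \<and> a v \<in> J} = (\<lambda>I. a ` I) ` {I \<in> MaxIrr K. u \<in> I \<and> v \<in> I}"
    (is "?L = ?R")
proof
  show "?R \<subseteq> ?L" using image_a_MaxIrr uv by auto
  show "?L \<subseteq> ?R"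
  proof
    fix J assume J: "J \<in> ?L"
    then have "irredundant H J" by (auto simp: MaxIrr_def)
    then show "J \<in> ?R"
    proof (cases rule: irredundant_cases)
      case (1 I)
      have "u \<in> I" "v \<in> I" using J 1 uv inj_a by (auto dest: inj_onD)
      then show ?thesis using J 1 MaxIrr_image_a by blast
    next
      case (2 I)
      then show ?thesis using J uv disj by blast
    next
      case (3 x y)
      have "a u \<noteq> a v" using uv inj_a by (auto dest: inj_onD)
      moreover have "a u \<noteq> b y" "a v \<noteq> b y" using disj uv 3 by blast+
      ultimately show ?thesis using J 3 by auto
    qed
  qed
qed

lemma MaxIrr_subset:
  "MaxIrr H \<subseteq> (`) a ` MaxIrr K \<union> (`) b ` MaxIrr K
     \<union> (\<lambda>(x, y). {a x, b y}) ` (pverts K \<times> pverts K)"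
proof
  fix J assume J: "J \<in> MaxIrr H"
  interpret sw: cobipartite_double K H b a by (rule swap)
  from J have "irredundant H J" by (auto simp: MaxIrr_def)
  then show "J \<in> (`) a ` MaxIrr K \<union> (`) b ` MaxIrr K
     \<union> (\<lambda>(x, y). {a x, b y}) ` (pverts K \<times> pverts K)"
    by (cases rule: irredundant_cases) (use J MaxIrr_image_a sw.MaxIrr_image_a in auto)
qed

text \<open>The two copies of \<open>MaxIrr K\<close> and the mixed pairs cover
  \<open>MaxIrr H\<close>. This keeps the output for \<open>H\<close> polynomial in the input and
  output for \<open>K\<close>.\<close>

lemma card_MaxIrr_le:
  assumes fin: "finite (pverts K)"
  shows "card (MaxIrr H) \<le> 2 * card (MaxIrr K) + card (pverts K) ^ 2"
proof -
  have "MaxIrr K \<subseteq> Pow (pverts K)" by (auto simp: MaxIrr_def irredundant_def)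
  then have finM: "finite (MaxIrr K)" using fin finite_subset by blast
  have "card (MaxIrr H) \<le> card ((`) a ` MaxIrr K \<union> (`) b ` MaxIrr K
     \<union> (\<lambda>(x, y). {a x, b y}) ` (pverts K \<times> pverts K))"
    by (rule card_mono[OF _ MaxIrr_subset]) (use fin finM in auto)
  also have "\<dots> \<le> card ((`) a ` MaxIrr K) + card ((`) b ` MaxIrr K)
     + card ((\<lambda>(x, y). {a x, b y}) ` (pverts K \<times> pverts K))"
    by (meson add_le_mono1 card_Un_le le_trans)
  also have "\<dots> \<le> card (MaxIrr K) + card (MaxIrr K) + card (pverts K \<times> pverts K)"
    by (intro add_mono card_image_le) (use fin finM in auto)
  finally show ?thesis by (simp add: card_cartesian_product power2_eq_square)
qed

end

section \<open>The reduction on graphs\<close>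

text \<open>The isolated vertices get the numbers 0 and 1 and the old ones are shifted by 2, so that
  the program only has to prepend entries to lists.\<close>

definition add_isolated :: "nat pair_pre_digraph \<Rightarrow> nat pair_pre_digraph" where
  "add_isolated G = \<lparr>pverts = {0..<card (pverts G) + 2},
     parcs = (\<lambda>(u, v). (u + 2, v + 2)) ` parcs G\<rparr>"

definition extend :: "nat set \<Rightarrow> nat set" where
  "extend I = {0, 1} \<union> (\<lambda>v. v + 2) ` I"

definition shrink :: "nat set \<Rightarrow> nat set" where
  "shrink J = {v. v + 2 \<in> J}"

lemma shrink_extend [simp]: "shrink (extend I) = I"
  by (auto simp: shrink_def extend_def)

lemma input_graphs_pverts: "G \<in> input_graphs \<Longrightarrow> pverts G = {0..<card (pverts G)}"
  unfolding input_graphs_def by clarify (metis card_atLeastLessThan diff_zero)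

lemma input_graphs_arcs:
  assumes "G \<in> input_graphs" "(u, v) \<in> parcs G"
  shows "u < card (pverts G)" "v < card (pverts G)" "u \<noteq> v" "(v, u) \<in> parcs G"
proof -
  interpret pair_graph G using assms by (auto simp: input_graphs_def)
  have "u \<in> pverts G" "v \<in> pverts G" using assms(2) in_arcsD1 in_arcsD2 by auto
  then show "u < card (pverts G)" "v < card (pverts G)"
    using input_graphs_pverts[OF assms(1)] by auto
  show "u \<noteq> v" using pair_no_loops[OF assms(2)] by simp
  show "(v, u) \<in> parcs G" using pair_sym_arcs assms(2) by (auto simp: symmetric_def sym_def)
qed

lemma input_graphsI:
  assumes "pverts G = {0..<n}"
    and "\<And>u v. (u, v) \<in> parcs G \<Longrightarrow> u < n \<and> v < n \<and> u \<noteq> v \<and> (v, u) \<in> parcs G"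
  shows "G \<in> input_graphs"
proof -
  have "parcs G \<subseteq> {0..<n} \<times> {0..<n}" using assms(2) by fastforce
  then have "finite (parcs G)" using finite_subset by blast
  then have "pair_graph G" using assms
    by unfold_locales (auto simp: sym_def symmetric_def)
  then show ?thesis using assms by (auto simp: input_graphs_def)
qed

lemma add_isolated_simps:
  shows "pverts (add_isolated G) = {0..<card (pverts G) + 2}"
    and "(u, v) \<in> parcs (add_isolated G)
      \<longleftrightarrow> 2 \<le> u \<and> 2 \<le> v \<and> (u - 2, v - 2) \<in> parcs G"
proof -
  show "(u, v) \<in> parcs (add_isolated G)
      \<longleftrightarrow> 2 \<le> u \<and> 2 \<le> v \<and> (u - 2, v - 2) \<in> parcs G"
    by (force simp: add_isolated_def intro: rev_image_eqI[where x = "(u - 2, v - 2)"])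
qed (simp add: add_isolated_def)

lemma add_isolated_input_graphs: "G \<in> input_graphs \<Longrightarrow> add_isolated G \<in> input_graphs"
proof (rule input_graphsI[OF add_isolated_simps(1)])
  fix u v assume "G \<in> input_graphs" "(u, v) \<in> parcs (add_isolated G)"
  then show "u < card (pverts G) + 2 \<and> v < card (pverts G) + 2 \<and> u \<noteq> v
      \<and> (v, u) \<in> parcs (add_isolated G)"
    using input_graphs_arcs[of G "u - 2" "v - 2"] by (auto simp: add_isolated_simps(2))
qed

lemma nat_cases_2:
  obtains "x = 0" | "x = Suc 0" | y where "x = Suc (Suc y)"
proof (cases x)
  case (Suc z)
  then show thesis using that by (cases z) auto
qed (use that in auto)

lemma closed_nbhd_add_isolated:
  "closed_nbhd (add_isolated G) 0 = {0}" "closed_nbhd (add_isolated G) (Suc 0) = {Suc 0}"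
  "closed_nbhd (add_isolated G) (Suc (Suc v)) = (\<lambda>v. Suc (Suc v)) ` closed_nbhd G v"
proof -
  show "closed_nbhd (add_isolated G) (Suc (Suc v)) = (\<lambda>v. Suc (Suc v)) ` closed_nbhd G v"
  proof (rule set_eqI)
    fix x
    show "x \<in> closed_nbhd (add_isolated G) (Suc (Suc v))
      \<longleftrightarrow> x \<in> (\<lambda>v. Suc (Suc v)) ` closed_nbhd G v"
      by (cases x rule: nat_cases_2) (auto simp: closed_nbhd_def add_isolated_simps)
  qed
qed (auto simp: closed_nbhd_def add_isolated_simps)

lemma priv_add_isolated:
  "priv (add_isolated G) (Suc (Suc x)) J = (\<lambda>v. Suc (Suc v)) ` priv G x (shrink J)"
proof -
  \<comment> \<open>The shift is injective and its image avoids 0 and 1, so these two elements of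
    \<open>J\<close> have no influence on old vertices.\<close>
  have eq: "(\<lambda>v. Suc (Suc v)) ` A \<inter> J = {Suc (Suc x)} \<longleftrightarrow> A \<inter> shrink J = {x}" for A
  proof -
    have "(\<lambda>v. Suc (Suc v)) ` A \<inter> J = (\<lambda>v. Suc (Suc v)) ` (A \<inter> shrink J)"
      by (auto simp: shrink_def)
    then show ?thesis
      using inj_image_eq_iff[of "\<lambda>v. Suc (Suc v)" "A \<inter> shrink J" "{x}"] by (simp add: inj_def)
  qed
  have "{y \<in> f ` N. P y} = f ` {y \<in> N. P (f y)}" for f :: "nat \<Rightarrow> nat" and N P by auto
  then show ?thesis by (simp add: priv_def closed_nbhd_add_isolated eq)
qed

text \<open>An isolated vertex is always its own private neighbour and is seen by no other vertex,
  so only the old part of \<open>J\<close> imposes a condition.\<close>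

lemma irredundant_add_isolated:
  assumes G: "G \<in> input_graphs"
  shows "irredundant (add_isolated G) J
    \<longleftrightarrow> J \<subseteq> pverts (add_isolated G) \<and> irredundant G (shrink J)"
proof -
  have "(\<forall>x\<in>J. priv (add_isolated G) x J \<noteq> {}) \<longleftrightarrow> (\<forall>x\<in>shrink J. priv G x (shrink J) \<noteq> {})"
  proof (intro iffI ballI)
    fix x assume "\<forall>x\<in>J. priv (add_isolated G) x J \<noteq> {}" "x \<in> shrink J"
    then show "priv G x (shrink J) \<noteq> {}"
      using priv_add_isolated[of G x J] by (auto simp: shrink_def)
  next
    fix x assume *: "\<forall>x\<in>shrink J. priv G x (shrink J) \<noteq> {}" and x: "x \<in> J"
    show "priv (add_isolated G) x J \<noteq> {}"
    proof (cases x rule: nat_cases_2)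
      case (3 y)
      then show ?thesis using * x priv_add_isolated[of G y J] by (auto simp: shrink_def)
    qed (use x in \<open>auto simp: priv_def closed_nbhd_add_isolated\<close>)
  qed
  moreover have "shrink J \<subseteq> pverts G" if "J \<subseteq> pverts (add_isolated G)"
    using that input_graphs_pverts[OF G] by (force simp: shrink_def add_isolated_simps)
  ultimately show ?thesis by (auto simp: irredundant_def)
qed

lemma extend_shrink:
  assumes "0 \<in> J" "1 \<in> J"
  shows "extend (shrink J) = J"
proof -
  have "x \<in> extend (shrink J) \<longleftrightarrow> x \<in> J" for x
    by (cases x rule: nat_cases_2) (use assms in \<open>auto simp: extend_def shrink_def\<close>)
  then show ?thesis by auto
qed

text \<open>Adding 0 and 1 never destroys irredundance, so every maximal set contains both and is
  determined by its old part.\<close>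

lemma MaxIrr_add_isolated:
  assumes G: "G \<in> input_graphs"
  shows "MaxIrr (add_isolated G) = extend ` MaxIrr G"
proof -
  let ?K = "add_isolated G"
  have sub: "extend I \<subseteq> pverts ?K" if "irredundant G I" for I
    using that input_graphs_pverts[OF G]
    by (force simp: extend_def add_isolated_simps irredundant_def)
  have ext: "irredundant ?K (extend I)" if "irredundant G I" for I
    using that sub by (simp add: irredundant_add_isolated[OF G])
  have le: "J \<subseteq> extend (shrink J)" for J
  proof
    fix x assume "x \<in> J"
    then show "x \<in> extend (shrink J)"
      \<comment> \<open>\<open>extend_shrink\<close> requires 0 and 1 to be present, so it is
        applied to \<open>J\<close> with both inserted; \<open>shrink\<close> ignores them.\<close>
      using extend_shrink[of "insert 0 (insert 1 J)"]
      by (auto simp: extend_def shrink_def image_iff)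
  qed
  have mono: "shrink J \<subseteq> shrink J'" if "J \<subseteq> J'" for J J' using that by (auto simp: shrink_def)
  show ?thesis
  proof (intro equalityI subsetI)
    fix J assume J: "J \<in> MaxIrr ?K"
    then have irr: "irredundant G (shrink J)"
      by (auto simp: MaxIrr_def irredundant_add_isolated[OF G])
    \<comment> \<open>\<open>extend (shrink J)\<close> is an irredundant superset of
      \<open>J\<close>, so maximality gives equality.\<close>
    have eq: "extend (shrink J) = J"
      using J ext[OF irr] le[of J] by (auto simp: MaxIrr_def)
    have "I = shrink J" if I: "irredundant G I" "shrink J \<subseteq> I" for I
    proof -
      have "extend (shrink J) \<subseteq> extend I" using I by (auto simp: extend_def)
      then have "J \<subseteq> extend I" by (simp only: eq)
      then have "extend I = J" using J ext[OF I(1)] by (auto simp: MaxIrr_def)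
      then show ?thesis by (metis shrink_extend)
    qed
    then have "shrink J \<in> MaxIrr G" using irr by (auto simp: MaxIrr_def)
    then show "J \<in> extend ` MaxIrr G" using eq by (metis imageI)
  next
    fix J assume "J \<in> extend ` MaxIrr G"
    then obtain I where I: "I \<in> MaxIrr G" "J = extend I" by auto
    have "J' = J" if J': "irredundant ?K J'" "J \<subseteq> J'" for J'
    proof -
      have "irredundant G (shrink J')" using J' by (auto simp: irredundant_add_isolated[OF G])
      moreover have "I \<subseteq> shrink J'" using mono[OF J'(2)] I by simp
      ultimately have "shrink J' = I" using I by (auto simp: MaxIrr_def)
      then show ?thesis using le[of J'] J' I by auto
    qed
    then show "J \<in> MaxIrr ?K" using I ext by (auto simp: MaxIrr_def)
  qed
qed

section \<open>The doubled graph on natural numbers\<close>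

text \<open>The vertex \<open>i\<close> of \<open>K\<close> becomes \<open>2 * (N - 1 - i)\<close> in one clique and its successor in the
  other: the program below builds lists by prepending, hence in reverse order.\<close>

definition copyA :: "nat \<Rightarrow> nat \<Rightarrow> nat" where "copyA N i = 2 * (N - 1 - i)"

definition copyB :: "nat \<Rightarrow> nat \<Rightarrow> nat" where "copyB N i = Suc (2 * (N - 1 - i))"

definition origin :: "nat \<Rightarrow> nat \<Rightarrow> nat" where "origin N k = N - 1 - k div 2"

text \<open>The parity of \<open>k\<close> tells its clique and \<open>origin N k\<close> the vertex
  of \<open>K\<close> it copies. Closed neighbourhoods join the two copies of the same
  vertex.\<close>

definition double :: "nat pair_pre_digraph \<Rightarrow> nat pair_pre_digraph" where
  "double K = (let N = card (pverts K) in
     \<lparr>pverts = {0..<2 * N},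
      parcs = {(k, l). k < 2 * N \<and> l < 2 * N \<and> k \<noteq> l \<and>
        (even k = even l \<or> origin N l \<in> closed_nbhd K (origin N k))}\<rparr>)"

lemma origin_copy [simp]:
  "i < N \<Longrightarrow> origin N (copyA N i) = i" "i < N \<Longrightarrow> origin N (copyB N i) = i"
  by (auto simp: origin_def copyA_def copyB_def)

lemma copy_less: "i < N \<Longrightarrow> copyA N i < 2 * N" "i < N \<Longrightarrow> copyB N i < 2 * N"
  by (auto simp: copyA_def copyB_def)

lemma copy_parity [simp]: "even (copyA N i)" "odd (copyB N i)"
  by (auto simp: copyA_def copyB_def)

lemma copy_cases:
  assumes "k < 2 * N"
  obtains i where "i < N" "k = copyA N i" | i where "i < N" "k = copyB N i"
proof (cases "even k")
  case True
  then show ?thesis using assms that(1)[of "origin N k"] by (auto simp: origin_def copyA_def elim!: evenE)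
next
  case False
  then show ?thesis using assms that(2)[of "origin N k"] by (auto simp: origin_def copyB_def elim!: oddE)
qed

lemma copy_inject [simp]:
  "i < N \<Longrightarrow> j < N \<Longrightarrow> copyA N i = copyA N j \<longleftrightarrow> i = j"
  "i < N \<Longrightarrow> j < N \<Longrightarrow> copyB N i = copyB N j \<longleftrightarrow> i = j"
  "copyA N i \<noteq> copyB N j" "copyB N i \<noteq> copyA N j"
  by (metis origin_copy copy_parity)+

lemma less_double_eq: "{0..<2 * N} = copyA N ` {0..<N} \<union> copyB N ` {0..<N}"
proof (intro equalityI subsetI)
  fix k assume "k \<in> {0..<2 * N}"
  then show "k \<in> copyA N ` {0..<N} \<union> copyB N ` {0..<N}" by (auto elim: copy_cases)
qed (auto simp: copy_less)

lemma double_pverts: "pverts (double K) = {0..<2 * card (pverts K)}"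
  by (simp add: double_def Let_def)

lemma closed_nbhd_sym:
  assumes "K \<in> input_graphs"
  shows "u \<in> closed_nbhd K v \<longleftrightarrow> v \<in> closed_nbhd K u"
  using input_graphs_arcs(4)[OF assms, of u v] input_graphs_arcs(4)[OF assms, of v u]
  by (auto simp: closed_nbhd_def)

lemma double_input_graphs:
  assumes K: "K \<in> input_graphs"
  shows "double K \<in> input_graphs"
  by (rule input_graphsI[OF double_pverts])
    (use closed_nbhd_sym[OF K] in \<open>auto simp: double_def Let_def\<close>)

lemma double_co_bipartite: "co_bipartite (double K)"
  unfolding co_bipartite_def
proof (intro exI conjI)
  let ?A = "{k \<in> pverts (double K). even k}" and ?B = "{k \<in> pverts (double K). odd k}"
  show "?A \<union> ?B = pverts (double K)" "?A \<inter> ?B = {}" by auto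
  show "is_clique (double K) ?A" "is_clique (double K) ?B"
    by (auto simp: is_clique_def double_def Let_def)
qed

lemma cobipartite_double_double:
  assumes K: "K \<in> input_graphs"
  defines "N \<equiv> card (pverts K)"
  shows "cobipartite_double K (double K) (copyA N) (copyB N)"
proof -
  have V: "pverts K = {0..<N}" using input_graphs_pverts[OF K] N_def by simp
  have nb: "closed_nbhd K x \<subseteq> pverts K" if "x \<in> pverts K" for x
    using that input_graphs_arcs(2)[OF K, folded N_def] by (auto simp: V closed_nbhd_def)
  have arcs: "(k, l) \<in> parcs (double K) \<longleftrightarrow> k < 2 * N \<and> l < 2 * N \<and> k \<noteq> l \<and>
        (even k = even l \<or> origin N l \<in> closed_nbhd K (origin N k))" for k l
    by (simp add: double_def Let_def N_def)
  have lt: "x < N" if "x \<in> closed_nbhd K y" "y < N" for x y using nb[of y] V that by auto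
  show ?thesis
  proof
    fix x assume x: "x \<in> pverts K"
    then show "closed_nbhd K x \<subseteq> pverts K" by (rule nb)
    have xN: "x < N" using x V by auto
    show "closed_nbhd (double K) (copyA N x) = copyA N ` pverts K \<union> copyB N ` closed_nbhd K x"
    proof (intro equalityI subsetI)
      fix k assume "k \<in> closed_nbhd (double K) (copyA N x)"
      then have "k < 2 * N" "k = copyA N x \<or> (copyA N x, k) \<in> parcs (double K)"
        using xN copy_less by (auto simp: closed_nbhd_def arcs)
      then show "k \<in> copyA N ` pverts K \<union> copyB N ` closed_nbhd K x"
        by (cases rule: copy_cases) (use xN V in \<open>auto simp: arcs\<close>)
    next
      fix k assume "k \<in> copyA N ` pverts K \<union> copyB N ` closed_nbhd K x"
      then show "k \<in> closed_nbhd (double K) (copyA N x)"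
        using xN V lt by (auto simp: closed_nbhd_def[of "double K"] arcs copy_less)
    qed
    show "closed_nbhd (double K) (copyB N x) = copyB N ` pverts K \<union> copyA N ` closed_nbhd K x"
    proof (intro equalityI subsetI)
      fix k assume "k \<in> closed_nbhd (double K) (copyB N x)"
      then have "k < 2 * N" "k = copyB N x \<or> (copyB N x, k) \<in> parcs (double K)"
        using xN copy_less by (auto simp: closed_nbhd_def arcs)
      then show "k \<in> copyB N ` pverts K \<union> copyA N ` closed_nbhd K x"
        by (cases rule: copy_cases) (use xN V in \<open>auto simp: arcs\<close>)
    next
      fix k assume "k \<in> copyB N ` pverts K \<union> copyA N ` closed_nbhd K x"
      then show "k \<in> closed_nbhd (double K) (copyB N x)"
        using xN V lt by (auto simp: closed_nbhd_def[of "double K"] arcs copy_less)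
    qed
  qed (use V in \<open>auto simp: inj_on_def double_pverts less_double_eq N_def[symmetric]\<close>)
qed

section \<open>Recovering the maximal irredundant sets of the original graph\<close>

definition reduct :: "nat pair_pre_digraph \<Rightarrow> nat pair_pre_digraph" where
  "reduct G = double (add_isolated G)"

text \<open>The vertices tested are the first copies of the two isolated vertices.\<close>

definition selected :: "nat pair_pre_digraph \<Rightarrow> nat set \<Rightarrow> bool" where
  "selected G J \<longleftrightarrow> (let N = card (pverts G) + 2 in copyA N 0 \<in> J \<and> copyA N 1 \<in> J)"

definition decode :: "nat pair_pre_digraph \<Rightarrow> nat set \<Rightarrow> nat set" where
  "decode G J = (let n = card (pverts G) in {v. v < n \<and> copyA (n + 2) (v + 2) \<in> J})"

lemma reduct_cobipartite:
  "G \<in> input_graphs \<Longrightarrow> reduct G \<in> {G \<in> input_graphs. co_bipartite G}"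
  by (simp add: reduct_def double_input_graphs add_isolated_input_graphs double_co_bipartite)

lemma card_reduct: "card (pverts (reduct G)) = 2 * (card (pverts G) + 2)"
  by (simp add: reduct_def double_pverts add_isolated_simps)

text \<open>This is the filter of the doubled graph taken at the isolated vertices. Every maximal
  irredundant set of \<open>add_isolated G\<close> contains both, so none is lost.\<close>

lemma selected_reduct:
  assumes G: "G \<in> input_graphs"
  shows "{J \<in> MaxIrr (reduct G). selected G J}
    = (\<lambda>I. copyA (card (pverts G) + 2) ` extend I) ` MaxIrr G"
proof -
  define N where "N = card (pverts G) + 2"
  let ?K = "add_isolated G"
  have c: "card (pverts ?K) = N" by (simp add: add_isolated_simps N_def)
  interpret cobipartite_double ?K "reduct G" "copyA N" "copyB N"
    using cobipartite_double_double[OF add_isolated_input_graphs[OF G]] c by (simp add: reduct_def)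
  have "{J \<in> MaxIrr (reduct G). copyA N 0 \<in> J \<and> copyA N 1 \<in> J}
    = (\<lambda>I. copyA N ` I) ` {I \<in> MaxIrr ?K. 0 \<in> I \<and> 1 \<in> I}"
    by (rule MaxIrr_with_two_a) (auto simp: add_isolated_simps)
  also have "{I \<in> MaxIrr ?K. 0 \<in> I \<and> 1 \<in> I} = extend ` MaxIrr G"
    by (auto simp: MaxIrr_add_isolated[OF G] extend_def)
  finally show ?thesis by (simp add: selected_def Let_def N_def image_image)
qed

lemma decode_copy:
  assumes G: "G \<in> input_graphs" and I: "I \<in> MaxIrr G"
  shows "decode G (copyA (card (pverts G) + 2) ` extend I) = I"
proof -
  define n where "n = card (pverts G)"
  have I': "I \<subseteq> {0..<n}"
    using I input_graphs_pverts[OF G] by (auto simp: n_def MaxIrr_def irredundant_def)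
  have "copyA (n + 2) (v + 2) \<in> copyA (n + 2) ` extend I \<longleftrightarrow> v \<in> I" if v: "v < n" for v
  proof -
    have inj: "inj_on (copyA (n + 2)) {0..<n + 2}" by (rule inj_onI) simp
    have "extend I \<subseteq> {0..<n + 2}" using I' by (auto simp: extend_def)
    then have "copyA (n + 2) (v + 2) \<in> copyA (n + 2) ` extend I \<longleftrightarrow> v + 2 \<in> extend I"
      using v by (intro inj_on_image_mem_iff[OF inj]) auto
    also have "v + 2 \<in> extend I \<longleftrightarrow> v \<in> I" by (auto simp: extend_def)
    finally show ?thesis .
  qed
  then show ?thesis using I' by (auto simp: decode_def Let_def n_def)
qed

text \<open>\<open>decode G\<close> inverts the map that parametrises the selected sets.
  Surjectivity makes the decoded list complete, injectivity keeps it free of repetitions.\<close>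

lemma decode_reduct:
  assumes G: "G \<in> input_graphs"
  shows "decode G ` {J \<in> MaxIrr (reduct G). selected G J} = MaxIrr G"
    and "inj_on (decode G) {J \<in> MaxIrr (reduct G). selected G J}"
proof -
  let ?e = "\<lambda>I. copyA (card (pverts G) + 2) ` extend I"
  have "decode G ` ?e ` MaxIrr G = (\<lambda>I. I) ` MaxIrr G"
    unfolding image_image by (rule image_cong[OF refl]) (rule decode_copy[OF G])
  then show "decode G ` {J \<in> MaxIrr (reduct G). selected G J} = MaxIrr G"
    unfolding selected_reduct[OF G] by simp
  show "inj_on (decode G) {J \<in> MaxIrr (reduct G). selected G J}"
    unfolding selected_reduct[OF G] by (rule inj_onI) (clarify, metis decode_copy[OF G])
qed

lemma card_MaxIrr_reduct:
  assumes G: "G \<in> input_graphs"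
  shows "card (MaxIrr (reduct G)) \<le> 2 * card (MaxIrr G) + (card (pverts G) + 2) ^ 2"
proof -
  let ?K = "add_isolated G"
  have c: "card (pverts ?K) = card (pverts G) + 2" by (simp add: add_isolated_simps)
  interpret cobipartite_double ?K "reduct G" "copyA (card (pverts G) + 2)" "copyB (card (pverts G) + 2)"
    using cobipartite_double_double[OF add_isolated_input_graphs[OF G]] c by (simp add: reduct_def)
  have "card (MaxIrr (reduct G)) \<le> 2 * card (MaxIrr ?K) + card (pverts ?K) ^ 2"
    by (rule card_MaxIrr_le) (simp add: add_isolated_simps)
  also have "card (MaxIrr ?K) = card (MaxIrr G)"
    unfolding MaxIrr_add_isolated[OF G] by (rule card_image) (metis inj_onI shrink_extend)
  finally show ?thesis by (simp add: c)
qed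

section \<open>Running programs\<close>

inductive_simps exec_Skip_iff: "exec Skip s t s'"
inductive_simps exec_Assign_iff: "exec (Assign x e) s t s'"
inductive_simps exec_Seq_iff: "exec (Seq c d) s t s'"
inductive_simps exec_Cond_iff: "exec (Cond e c d) s t s'"
inductive_cases exec_WhileE: "exec (While e c) s t s'"

lemma exec_deterministic:
  "exec c s t s' \<Longrightarrow> exec c s u s'' \<Longrightarrow> t = u \<and> s' = s''"
proof (induction arbitrary: u s'' rule: exec.induct)
  case (Seq c s t s' d t' s2)
  from Seq.prems show ?case by (auto simp: exec_Seq_iff dest!: Seq.IH)
next
  case (CondTrue e s c t s' d)
  from CondTrue.prems CondTrue.hyps show ?case by (auto simp: exec_Cond_iff dest!: CondTrue.IH)
next
  case (CondFalse e s d t s' c)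
  from CondFalse.prems CondFalse.hyps show ?case by (auto simp: exec_Cond_iff dest!: CondFalse.IH)
next
  case (WhileTrue e s c t s' t' s2)
  from WhileTrue.prems show ?case
    by (cases rule: exec_WhileE) (use WhileTrue.hyps in \<open>auto dest!: WhileTrue.IH\<close>)
next
  case (WhileFalse e s c)
  from WhileFalse.prems show ?case by (cases rule: exec_WhileE) (use WhileFalse.hyps in auto)
qed (auto simp: exec_Skip_iff exec_Assign_iff)

text \<open>Correctness and the time bound each assert the existence of a run; determinism
  identifies these runs.\<close>

lemma computes_deterministic:
  "computes c i t out \<Longrightarrow> computes c i u out' \<Longrightarrow> t = u \<and> out = out'"
  unfolding computes_def using exec_deterministic by metis

section \<open>Independence of variables that do not occur\<close>

fun expr_bound :: "expr \<Rightarrow> nat" where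
  "expr_bound (Var x) = Suc x"
| "expr_bound AtomE = 0"
| "expr_bound (PairE e f) = max (expr_bound e) (expr_bound f)"
| "expr_bound (LeftE e) = expr_bound e"
| "expr_bound (RightE e) = expr_bound e"

fun var_bound :: "prog \<Rightarrow> nat" where
  "var_bound Skip = 0"
| "var_bound (Assign x e) = max (Suc x) (expr_bound e)"
| "var_bound (Seq c d) = max (var_bound c) (var_bound d)"
| "var_bound (Cond e c d) = max (expr_bound e) (max (var_bound c) (var_bound d))"
| "var_bound (While e c) = max (expr_bound e) (var_bound c)"

lemma eval_expr_cong: "expr_bound e \<le> k \<Longrightarrow> \<forall>x<k. s x = s1 x \<Longrightarrow> eval_expr e s = eval_expr e s1"
  by (induction e) auto

text \<open>The given program expects all variables but 0 to hold \<open>Atom\<close>, while the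
  preprocessing leaves data in variables from \<open>k\<close> on. Beyond \<open>var_bound\<close>
  such data affect neither the run nor its time.\<close>

lemma exec_frame:
  "exec c s t s' \<Longrightarrow> var_bound c \<le> k \<Longrightarrow> \<forall>x<k. s x = s1 x \<Longrightarrow>
    \<exists>s1'. exec c s1 t s1' \<and> (\<forall>x<k. s' x = s1' x)"
proof (induction arbitrary: s1 rule: exec.induct)
  case (Skip s)
  then show ?case by (blast intro: exec.Skip)
next
  case (Assign x e s)
  then have "eval_expr e s = eval_expr e s1" by (intro eval_expr_cong) auto
  then show ?case using Assign exec.Assign[of x e s1] by (intro exI conjI) (assumption, auto)
next
  case (Seq c s t s' d t' s'')
  from Seq.prems Seq.IH(1)[of s1] obtain s2 where 1: "exec c s1 t s2" "\<forall>x<k. s' x = s2 x" by auto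
  from Seq.prems Seq.IH(2)[of s2] 1(2) obtain s3 where 2: "exec d s2 t' s3" "\<forall>x<k. s'' x = s3 x" by auto
  show ?case using exec.Seq[OF 1(1) 2(1)] 2(2) by auto
next
  case (CondTrue e s c t s' d)
  then have e: "eval_expr e s1 \<noteq> Atom" using eval_expr_cong[of e k s s1] by auto
  from CondTrue.prems CondTrue.IH[of s1] obtain s2 where "exec c s1 t s2" "\<forall>x<k. s' x = s2 x" by auto
  then show ?case using exec.CondTrue[OF e, of c t s2 d] by auto
next
  case (CondFalse e s d t s' c)
  then have e: "eval_expr e s1 = Atom" using eval_expr_cong[of e k s s1] by auto
  from CondFalse.prems CondFalse.IH[of s1] obtain s2 where "exec d s1 t s2" "\<forall>x<k. s' x = s2 x" by auto
  then show ?case using exec.CondFalse[OF e, of d t s2 c] by auto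
next
  case (WhileTrue e s c t s' t' s'')
  then have e: "eval_expr e s1 \<noteq> Atom" using eval_expr_cong[of e k s s1] by auto
  obtain s1' where 1: "exec c s1 t s1'" "\<forall>x<k. s' x = s1' x"
    using WhileTrue.IH(1)[of s1] WhileTrue.prems by auto
  obtain s1'' where 2: "exec (While e c) s1' t' s1''" "\<forall>x<k. s'' x = s1'' x"
    using WhileTrue.IH(2)[OF WhileTrue.prems(1) 1(2)] by auto
  show ?case using exec.WhileTrue[OF e 1(1) 2(1)] 2(2) by auto
next
  case (WhileFalse e s c)
  then have "eval_expr e s1 = Atom" using eval_expr_cong[of e k s s1] by auto
  with WhileFalse show ?case by (blast intro: exec.WhileFalse)
qed

section \<open>Total correctness with time budgets\<close>

text \<open>A total-correctness triple at a fixed initial store; \<open>T\<close> is only an upper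
  bound, so generous constants suffice later.\<close>

definition halts :: "prog \<Rightarrow> store \<Rightarrow> nat \<Rightarrow> (store \<Rightarrow> bool) \<Rightarrow> bool" where
  "halts c s T P \<longleftrightarrow> (\<exists>t s'. exec c s t s' \<and> t \<le> T \<and> P s')"

lemma halts_mono:
  "halts c s T P \<Longrightarrow> T \<le> T' \<Longrightarrow> (\<And>s'. P s' \<Longrightarrow> Q s') \<Longrightarrow> halts c s T' Q"
  unfolding halts_def by (meson le_trans)

lemma halts_Seq:
  "halts c s T (\<lambda>s'. halts d s' T' P) \<Longrightarrow> halts (Seq c d) s (T + T') P"
  unfolding halts_def by (blast intro: exec.Seq add_mono)

lemma halts_Assign_iff:
  "halts (Assign x e) s T P \<longleftrightarrow> 1 + expr_cost e \<le> T \<and> P (s(x := eval_expr e s))"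
  by (auto simp: halts_def exec_Assign_iff)

lemma halts_Skip_iff: "halts Skip s T P \<longleftrightarrow> 1 \<le> T \<and> P s"
  by (auto simp: halts_def exec_Skip_iff)

text \<open>As a rewrite rule this lets the simplifier run straight-line code, charging each
  assignment to the remaining budget.\<close>

lemma halts_Seq_Assign_iff:
  "halts (Seq (Assign x e) d) s T P
    \<longleftrightarrow> 1 + expr_cost e \<le> T \<and> halts d (s(x := eval_expr e s)) (T - (1 + expr_cost e)) P"
proof
  assume "halts (Seq (Assign x e) d) s T P"
  then show "1 + expr_cost e \<le> T \<and> halts d (s(x := eval_expr e s)) (T - (1 + expr_cost e)) P"
    unfolding halts_def by (force simp: exec_Seq_iff exec_Assign_iff)
next
  assume *: "1 + expr_cost e \<le> T \<and> halts d (s(x := eval_expr e s)) (T - (1 + expr_cost e)) P"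
  then have "halts (Seq (Assign x e) d) s (1 + expr_cost e + (T - (1 + expr_cost e))) P"
    by (intro halts_Seq) (simp add: halts_Assign_iff)
  then show "halts (Seq (Assign x e) d) s T P" using * by simp
qed

lemmas halts_simps = halts_Assign_iff halts_Skip_iff halts_Seq_Assign_iff

lemma halts_Cond:
  assumes "1 + expr_cost e \<le> T"
    and "halts (if eval_expr e s = Atom then d else c) s (T - (1 + expr_cost e)) P"
  shows "halts (Cond e c d) s T P"
proof -
  obtain t s' where *: "exec (if eval_expr e s = Atom then d else c) s t s'"
    "t \<le> T - (1 + expr_cost e)" "P s'"
    using assms(2) by (auto simp: halts_def)
  then have "exec (Cond e c d) s (1 + expr_cost e + t) s'"
    by (cases "eval_expr e s = Atom") (simp_all only: exec.CondTrue exec.CondFalse if_True if_False simp_thms not_False_eq_True)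
  then show ?thesis unfolding halts_def using * assms(1)
    by (intro exI[of _ "1 + expr_cost e + t"] exI[of _ s']) auto
qed

text \<open>The index of the invariant counts completed iterations. The last summand of the time
  bound pays for the final, failing test.\<close>

lemma halts_For:
  assumes step: "\<And>j s. j < m \<Longrightarrow> I j s \<Longrightarrow> eval_expr e s \<noteq> Atom \<and> halts c s T (I (Suc j))"
    and stop: "\<And>s. I m s \<Longrightarrow> eval_expr e s = Atom"
    and init: "I 0 s"
  shows "halts (While e c) s (m * (1 + expr_cost e + T) + (1 + expr_cost e)) (I m)"
proof -
  \<comment> \<open>Generalised to any point of the loop: \<open>d\<close> iterations remain after
    \<open>j\<close> have been done.\<close>
  have "halts (While e c) s (d * (1 + expr_cost e + T) + (1 + expr_cost e)) (I m)"
    if "j + d = m" "I j s" for j d s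
    using that
  proof (induction d arbitrary: j s)
    case 0
    then show ?case using exec.WhileFalse[of e s c] stop[of s] by (auto simp: halts_def)
  next
    case (Suc d)
    then have e: "eval_expr e s \<noteq> Atom" and "halts c s T (I (Suc j))" using step[of j s] by auto
    then obtain t s' where 1: "exec c s t s'" "t \<le> T" "I (Suc j) s'" by (auto simp: halts_def)
    then obtain t' s'' where 2: "exec (While e c) s' t' s''"
      "t' \<le> d * (1 + expr_cost e + T) + (1 + expr_cost e)" "I m s''"
      using Suc.IH[of "Suc j" s'] Suc.prems by (auto simp: halts_def)
    show ?case unfolding halts_def
      using exec.WhileTrue[OF e 1(1) 2(1)] 1(2) 2(2,3)
      by (intro exI conjI) (assumption, auto)
  qed
  then show ?thesis using init by auto
qed

section \<open>The reduction as a program\<close>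

lemma halts_SeqI:
  assumes "halts c s T1 Q" "T1 \<le> T" "\<And>s'. Q s' \<Longrightarrow> halts d s' (T - T1) P"
  shows "halts (Seq c d) s T P"
proof -
  have "halts (Seq c d) s (T1 + (T - T1)) P"
    by (rule halts_Seq, rule halts_mono[OF assms(1) order_refl], rule assms(3))
  then show ?thesis using assms(2) by simp
qed

fun seq :: "prog list \<Rightarrow> prog" where
  "seq [] = Skip"
| "seq (c # cs) = Seq c (seq cs)"

section \<open>Interleaved lists and their encodings\<close>

text \<open>The list left behind by a loop that prepends \<open>f i\<close> and \<open>g i\<close>
  in round \<open>i\<close>; indices therefore descend.\<close>

primrec pairs :: "(nat \<Rightarrow> 'a) \<Rightarrow> (nat \<Rightarrow> 'a) \<Rightarrow> nat \<Rightarrow> 'a list" where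
  "pairs f g 0 = []"
| "pairs f g (Suc n) = f n # g n # pairs f g n"

text \<open>Matches list positions with the vertex numbers of \<open>double\<close>: even positions
  belong to \<open>copyA\<close>, odd ones to \<open>copyB\<close>.\<close>

lemma pairs_eq_map:
  "pairs f g N = map (\<lambda>k. if even k then f (origin N k) else g (origin N k)) [0..<2 * N]"
proof (induction N)
  case (Suc N)
  have "[0..<2 * Suc N] = 0 # 1 # map (\<lambda>k. Suc (Suc k)) [0..<2 * N]"
    by (simp add: upt_conv_Cons map_Suc_upt[symmetric] comp_def del: upt_Suc)
  then show ?case by (simp add: Suc origin_def del: upt_Suc)
qed simp

lemma enc_list_eq_Atom_iff [simp]: "enc_list xs = Atom \<longleftrightarrow> xs = []"
  by (cases xs) auto

lemma right_enc_list [simp]: "right (enc_list xs) = enc_list (tl xs)"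
  by (cases xs) auto

lemma left_enc_list: "left (enc_list xs) = (if xs = [] then Atom else hd xs)"
  by (cases xs) auto

lemma right_funpow_enc_list: "(right ^^ j) (enc_list xs) = enc_list (drop j xs)"
  by (induction j) (auto simp: drop_Suc tl_drop)

lemma enc_bool_eq_Atom_iff [simp]: "enc_bool b = Atom \<longleftrightarrow> \<not> b"
  by (simp add: enc_bool_def)

abbreviation "one \<equiv> PairE AtomE AtomE"

section \<open>Constructing the adjacency matrix of the reduced graph\<close>

text \<open>Variable \<open>k + 4\<close> holds the rest of row \<open>i\<close> of the adjacency matrix, and \<open>k + 5\<close> a list of
  length \<open>i + 1 - j\<close> in column \<open>j\<close>, so that the diagonal is the place where it is a singleton.
  The two rows of the doubled matrix accumulate in \<open>k + 7\<close> and \<open>k + 8\<close>.\<close>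

definition row_step :: "nat \<Rightarrow> prog" where
  "row_step k =
    (let off = Seq (Assign (k + 7) (PairE one (PairE (LeftE (Var (k + 4))) (Var (k + 7)))))
                   (Assign (k + 8) (PairE (LeftE (Var (k + 4))) (PairE one (Var (k + 8)))));
         diag = Seq (Assign (k + 7) (PairE AtomE (PairE one (Var (k + 7)))))
                    (Assign (k + 8) (PairE one (PairE AtomE (Var (k + 8)))))
     in Cond (Var (k + 5)) (Cond (RightE (Var (k + 5))) off diag) off)"

definition row_loop :: "nat \<Rightarrow> prog" where
  "row_loop k = While (Var (k + 6)) (seq [row_step k,
     Assign (k + 4) (RightE (Var (k + 4))),
     Assign (k + 5) (RightE (Var (k + 5))),
     Assign (k + 6) (RightE (Var (k + 6)))])"

text \<open>Before, on and after the diagonal the list in \<open>k + 5\<close> has at least two,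
  exactly one and no elements; truncated subtraction gives the last case.\<close>

lemma halts_row_step:
  assumes r: "left (s (k + 4)) = enc_bool E" and d: "s (k + 5) = enc_list (replicate (Suc i - j) Atom)"
  shows "halts (row_step k) s 40 (\<lambda>s'. s' = s(
     k + 7 := Dot (enc_bool (j \<noteq> i)) (Dot (enc_bool (j = i \<or> E)) (s (k + 7))),
     k + 8 := Dot (enc_bool (j = i \<or> E)) (Dot (enc_bool (j \<noteq> i)) (s (k + 8)))))"
proof -
  consider "j < i" | "j = i" | "i < j" by linarith
  then show ?thesis
  proof cases
    case 1
    then have "\<exists>m. Suc i - j = Suc (Suc m)" by (intro exI[of _ "i - j - 1"]) auto
    with 1 show ?thesis
      by (auto simp: row_step_def Let_def halts_simps r d enc_bool_def intro!: halts_Cond)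
  qed (auto simp: row_step_def Let_def halts_simps r d enc_bool_def intro!: halts_Cond)
qed

text \<open>The row is accessed through \<open>left\<close> and \<open>right\<close> only, so it may
  be shorter than \<open>N\<close>: missing entries read as \<open>Atom\<close>, that is, false. The
  list in \<open>k + 6\<close> merely counts the columns.\<close>

lemma halts_row_loop:
  assumes h: "s (k + 6) = enc_list hs" "length hs = N"
    and r: "\<And>j. j < N \<Longrightarrow> left ((right ^^ j) (s (k + 4))) = enc_bool (E j)"
    and d: "s (k + 5) = enc_list (replicate (Suc i) Atom)"
    and acc: "s (k + 7) = Atom" "s (k + 8) = Atom"
  shows "halts (row_loop k) s (N * 82 + 2) (\<lambda>s'.
     s' (k + 7) = enc_list (pairs (\<lambda>j. enc_bool (j \<noteq> i)) (\<lambda>j. enc_bool (j = i \<or> E j)) N) \<and>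
     s' (k + 8) = enc_list (pairs (\<lambda>j. enc_bool (j = i \<or> E j)) (\<lambda>j. enc_bool (j \<noteq> i)) N) \<and>
     (\<forall>x. x < k + 4 \<longrightarrow> s' x = s x))"
proof -
  define I where "I j s' \<longleftrightarrow> s' (k + 6) = enc_list (drop j hs) \<and> s' (k + 4) = (right ^^ j) (s (k + 4)) \<and>
     s' (k + 5) = enc_list (replicate (Suc i - j) Atom) \<and>
     s' (k + 7) = enc_list (pairs (\<lambda>j. enc_bool (j \<noteq> i)) (\<lambda>j. enc_bool (j = i \<or> E j)) j) \<and>
     s' (k + 8) = enc_list (pairs (\<lambda>j. enc_bool (j = i \<or> E j)) (\<lambda>j. enc_bool (j \<noteq> i)) j) \<and>
     (\<forall>x. x < k + 4 \<longrightarrow> s' x = s x)" for j :: nat and s' :: store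
  have "halts (row_loop k) s (N * (1 + expr_cost (Var (k + 6)) + 80) + (1 + expr_cost (Var (k + 6)))) (I N)"
    unfolding row_loop_def
  proof (rule halts_For)
    fix j s' assume j: "j < N" and I: "I j s'"
    have "halts (row_step k) s' 40 (\<lambda>s''. s'' = s'(
     k + 7 := Dot (enc_bool (j \<noteq> i)) (Dot (enc_bool (j = i \<or> E j)) (s' (k + 7))),
     k + 8 := Dot (enc_bool (j = i \<or> E j)) (Dot (enc_bool (j \<noteq> i)) (s' (k + 8)))))"
      by (rule halts_row_step) (use I r[OF j] in \<open>auto simp: I_def\<close>)
    then have "halts (seq [row_step k,
     Assign (k + 4) (RightE (Var (k + 4))),
     Assign (k + 5) (RightE (Var (k + 5))),
     Assign (k + 6) (RightE (Var (k + 6)))]) s' 80 (I (Suc j))"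
      unfolding seq.simps
      by (rule halts_SeqI) (use I in \<open>auto simp: halts_simps I_def tl_drop drop_Suc\<close>)
    then show "eval_expr (Var (k + 6)) s' \<noteq> Atom \<and> halts (seq [row_step k,
     Assign (k + 4) (RightE (Var (k + 4))),
     Assign (k + 5) (RightE (Var (k + 5))),
     Assign (k + 6) (RightE (Var (k + 6)))]) s' 80 (I (Suc j))"
      using I j h by (auto simp: I_def)
  qed (use assms in \<open>auto simp: I_def\<close>)
  then show ?thesis by (rule halts_mono) (auto simp: I_def)
qed

text \<open>Prepending two false entries to the row list, and to each row, realises the two isolated
  vertices; the two new rows may stay empty since \<^term>\<open>left Atom = Atom\<close> encodes false.\<close>

definition prep_body :: "nat \<Rightarrow> prog" where
  "prep_body k = seq [
     Assign (k + 4) (PairE AtomE (PairE AtomE (LeftE (Var (k + 1))))),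
     Assign (k + 5) (Var (k + 2)),
     Assign (k + 6) (Var k),
     Assign (k + 7) AtomE,
     Assign (k + 8) AtomE,
     row_loop k,
     Assign (k + 3) (PairE (Var (k + 7)) (PairE (Var (k + 8)) (Var (k + 3)))),
     Assign (k + 2) (PairE AtomE (Var (k + 2))),
     Assign (k + 1) (RightE (Var (k + 1)))]"

text \<open>Variable \<open>k\<close> keeps the extended row list and doubles as a column counter of
  length \<open>N\<close> for every row. \<open>k + 1\<close> holds the rows still to be read,
  \<open>k + 2\<close> the initial diagonal marker, and \<open>k + 3\<close> the finished
  rows.\<close>

definition prep :: "nat \<Rightarrow> prog" where
  "prep k = seq [
     Assign k (PairE AtomE (PairE AtomE (Var 0))),
     Assign (k + 1) (Var k),
     Assign (k + 2) one,
     Assign (k + 3) AtomE,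
     While (Var (k + 1)) (prep_body k),
     Assign 0 (Var (k + 3))]"

definition graph_rows :: "nat pair_pre_digraph \<Rightarrow> sexp list" where
  "graph_rows G = (let n = card (pverts G) in
     map (\<lambda>u. enc_list (map (\<lambda>v. enc_bool ((u, v) \<in> parcs G)) [0..<n])) [0..<n])"

lemma enc_graph_rows: "enc_graph G = enc_list (graph_rows G)"
  by (simp add: enc_graph_def graph_rows_def Let_def)

lemma add_isolated_entry:
  assumes "i < card (pverts G) + 2" "j < card (pverts G) + 2"
  shows "left ((right ^^ j) (Dot Atom (Dot Atom (left (enc_list (drop i (Atom # Atom # graph_rows G)))))))
    = enc_bool ((i, j) \<in> parcs (add_isolated G))"
proof -
  \<comment> \<open>For the isolated vertices \<open>row\<close> is the empty list; otherwise it is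
    a row of the original matrix, without the two new columns.\<close>
  obtain row where row: "left (enc_list (drop i (Atom # Atom # graph_rows G))) = enc_list row"
    "\<And>j. (if j < length row then row ! j else Atom) = enc_bool (2 \<le> i \<and> j < card (pverts G) \<and> (i - 2, j) \<in> parcs G)"
  proof (cases i rule: nat_cases_2)
    case (3 y)
    show thesis
      by (rule that[of "map (\<lambda>v. enc_bool ((y, v) \<in> parcs G)) [0..<card (pverts G)]"])
        (use 3 assms(1) in \<open>auto simp: graph_rows_def Let_def left_enc_list hd_drop_conv_nth enc_bool_def\<close>)
  qed (auto intro!: that[of "[]"] simp: enc_bool_def)
  have "left ((right ^^ j) (enc_list xs)) = (if j < length xs then xs ! j else Atom)" for xs
    by (auto simp: right_funpow_enc_list left_enc_list hd_drop_conv_nth)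
  from this[of "Atom # Atom # row"] show ?thesis
    using row(2)[of "j - 2"] assms(2) unfolding row(1) enc_list.simps(2)[symmetric]
    by (cases j rule: nat_cases_2) (auto simp: add_isolated_simps enc_bool_def)
qed

text \<open>\<open>f\<close> lists the entries inside the own clique, where only the diagonal is
  false; \<open>g\<close> lists those towards the other clique. The flag \<open>b\<close> is true
  for the clique of \<open>copyA\<close>.\<close>

definition double_row :: "nat pair_pre_digraph \<Rightarrow> bool \<Rightarrow> nat \<Rightarrow> sexp" where
  "double_row K b i =
     (let f = (\<lambda>j. enc_bool (j \<noteq> i)); g = (\<lambda>j. enc_bool (j = i \<or> (i, j) \<in> parcs K)) in
      enc_list (if b then pairs f g (card (pverts K)) else pairs g f (card (pverts K))))"

lemma enc_graph_double:
  "enc_graph (double K) = enc_list (pairs (double_row K True) (double_row K False) (card (pverts K)))"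
proof -
  define N where "N = card (pverts K)"
  have c: "card (pverts (double K)) = 2 * N" by (simp add: double_pverts N_def)
  \<comment> \<open>Within one clique distinct vertices have distinct origins, so comparing origins
    correctly excludes loops.\<close>
  have eq: "origin N l = origin N k \<longleftrightarrow> l = k" if "k < 2 * N" "l < 2 * N" "even k = even l" for k l
    using that(1,2) by (cases rule: copy_cases[case_product copy_cases]) (use that(3) in auto)
  have "(if even k then double_row K True (origin N k) else double_row K False (origin N k))
    = enc_list (map (\<lambda>l. enc_bool ((k, l) \<in> parcs (double K))) [0..<2 * N])"
    if k: "k < 2 * N" for k
    using k eq[OF k]
    by (auto simp: double_row_def Let_def pairs_eq_map N_def[symmetric] double_def closed_nbhd_def
        intro!: arg_cong[of _ _ enc_list] arg_cong[of _ _ enc_bool])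
  then show ?thesis
    unfolding enc_graph_def Let_def c N_def[symmetric] pairs_eq_map
    by (intro arg_cong[of _ _ enc_list] map_cong) auto
qed

text \<open>Each of the \<open>N\<close> rows costs one inner loop plus a constant. Variables
  strictly between 0 and \<open>k\<close> are preserved, so the given program finds them still
  \<open>Atom\<close>.\<close>

lemma halts_prep:
  assumes k: "0 < k" and s: "s 0 = enc_graph G" 
  defines "N \<equiv> card (pverts G) + 2"
  shows "halts (prep k) s (N * (N * 82 + 100) + 100)
    (\<lambda>s'. s' 0 = enc_graph (reduct G) \<and> (\<forall>x. 0 < x \<and> x < k \<longrightarrow> s' x = s x))"
proof -
  let ?K = "add_isolated G"
  define hs where "hs = Atom # Atom # graph_rows G"
  have len: "length hs = N" by (simp add: hs_def graph_rows_def Let_def N_def)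
  have c: "card (pverts ?K) = N" by (simp add: add_isolated_simps N_def)
  define I where "I i s' \<longleftrightarrow> s' k = enc_list hs \<and> s' (k + 1) = enc_list (drop i hs) \<and>
     s' (k + 2) = enc_list (replicate (Suc i) Atom) \<and>
     s' (k + 3) = enc_list (pairs (double_row ?K True) (double_row ?K False) i) \<and>
     (\<forall>x. 0 < x \<and> x < k \<longrightarrow> s' x = s x)" for i :: nat and s' :: store
  have body: "halts (prep_body k) s' (N * 82 + 80) (I (Suc i))" if i: "i < N" and I: "I i s'" for i s'
  proof -
    let ?s = "s'(k + 4 := Dot Atom (Dot Atom (left (s' (k + 1)))), k + 5 := s' (k + 2),
      k + 6 := s' k, k + 7 := Atom, k + 8 := Atom)"
    have loop: "halts (row_loop k) ?s (N * 82 + 2) (\<lambda>s''.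
      s'' (k + 7) = enc_list (pairs (\<lambda>j. enc_bool (j \<noteq> i)) (\<lambda>j. enc_bool (j = i \<or> (i, j) \<in> parcs ?K)) N) \<and>
      s'' (k + 8) = enc_list (pairs (\<lambda>j. enc_bool (j = i \<or> (i, j) \<in> parcs ?K)) (\<lambda>j. enc_bool (j \<noteq> i)) N) \<and>
      (\<forall>x. x < k + 4 \<longrightarrow> s'' x = ?s x))"
    proof (rule halts_row_loop)
      show "left ((right ^^ j) (?s (k + 4))) = enc_bool ((i, j) \<in> parcs ?K)" if "j < N" for j
        using add_isolated_entry[of i G j] i that I by (simp add: I_def hs_def N_def)
    qed (use I len in \<open>auto simp: I_def\<close>)
    have "halts (Seq (row_loop k) (seq [
      Assign (k + 3) (PairE (Var (k + 7)) (PairE (Var (k + 8)) (Var (k + 3)))),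
      Assign (k + 2) (PairE AtomE (Var (k + 2))),
      Assign (k + 1) (RightE (Var (k + 1)))])) ?s (N * 82 + 50) (I (Suc i))"
      by (rule halts_SeqI[OF loop])
        (use I in \<open>auto simp: halts_simps I_def double_row_def Let_def c tl_drop drop_Suc\<close>)
    then show ?thesis
      by (simp add: prep_body_def halts_simps) (erule halts_mono; simp)
  qed
  have loop: "halts (While (Var (k + 1)) (prep_body k)) s'
    (N * (1 + expr_cost (Var (k + 1)) + (N * 82 + 80)) + (1 + expr_cost (Var (k + 1)))) (I N)"
    if "I 0 s'" for s'
  proof (rule halts_For)
    fix i s'' assume "i < N" "I i s''"
    then show "eval_expr (Var (k + 1)) s'' \<noteq> Atom \<and> halts (prep_body k) s'' (N * 82 + 80) (I (Suc i))"
      using body len by (auto simp: I_def[of i])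
  qed (use that len in \<open>auto simp: I_def\<close>)
  have "halts (Seq (While (Var (k + 1)) (prep_body k)) (seq [Assign 0 (Var (k + 3))])) s'
     (N * (N * 82 + 82) + 20)
     (\<lambda>s'. s' 0 = enc_graph (reduct G) \<and> (\<forall>x. 0 < x \<and> x < k \<longrightarrow> s' x = s x))"
    if "I 0 s'" for s'
    by (rule halts_SeqI[OF loop[OF that]])
      (auto simp: halts_simps I_def reduct_def enc_graph_double c algebra_simps)
  moreover have "I 0 (s(k := Dot Atom (Dot Atom (s 0)), k + 1 := Dot Atom (Dot Atom (s 0)),
      k + 2 := Dot Atom Atom, k + 3 := Atom))"
    by (simp add: I_def s hs_def enc_graph_rows)
  ultimately have "halts (Seq (While (Var (k + 1)) (prep_body k)) (seq [Assign 0 (Var (k + 3))]))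
    (s(k := Dot Atom (Dot Atom (s 0)), k + 1 := Dot Atom (Dot Atom (s 0)),
      k + 2 := Dot Atom Atom, k + 3 := Atom)) (N * (N * 82 + 82) + 20)
    (\<lambda>s'. s' 0 = enc_graph (reduct G) \<and> (\<forall>x. 0 < x \<and> x < k \<longrightarrow> s' x = s x))"
    by blast
  then show ?thesis
    using k by (simp add: prep_def halts_simps) (erule halts_mono; simp add: algebra_simps)
qed

section \<open>Filtering and decoding the output list\<close>

text \<open>Keeps the entries of the first clique only. They come in descending order of origin, so
  prepending restores ascending order.\<close>

definition split_vset :: "nat \<Rightarrow> prog" where
  "split_vset k = While (Var k) (seq [
     Assign (k + 1) (PairE (LeftE (Var k)) (Var (k + 1))),
     Assign k (RightE (RightE (Var k)))])"

text \<open>The two leading entries belong to the isolated vertices; the remaining ones already form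
  the characteristic vector of the decoded set.\<close>

definition post_test :: "nat \<Rightarrow> prog" where
  "post_test k = Cond (LeftE (Var (k + 1))) (Cond (LeftE (RightE (Var (k + 1))))
     (Assign (k + 2) (PairE (RightE (RightE (Var (k + 1)))) (Var (k + 2)))) Skip) Skip"

definition post_body :: "nat \<Rightarrow> prog" where
  "post_body k = seq [
     Assign k (LeftE (Var 0)),
     Assign 0 (RightE (Var 0)),
     Assign (k + 1) AtomE,
     split_vset k,
     post_test k]"

definition post :: "nat \<Rightarrow> prog" where
  "post k = seq [Assign (k + 2) AtomE, While (Var 0) (post_body k), Assign 0 (Var (k + 2))]"

lemma halts_split_vset:
  assumes "s k = enc_list (pairs f g N)" "s (k + 1) = Atom"
  shows "halts (split_vset k) s (N * 22 + 2) (\<lambda>s'. s' (k + 1) = enc_list (map f [0..<N]) \<and>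
    (\<forall>x. x \<noteq> k \<and> x \<noteq> k + 1 \<longrightarrow> s' x = s x))"
proof -
  \<comment> \<open>After \<open>j\<close> rounds the \<open>j\<close> largest origins have been
    moved.\<close>
  define I where "I j s' \<longleftrightarrow> s' k = enc_list (pairs f g (N - j)) \<and>
    s' (k + 1) = enc_list (map f [N - j..<N]) \<and> (\<forall>x. x \<noteq> k \<and> x \<noteq> k + 1 \<longrightarrow> s' x = s x)"
    for j :: nat and s' :: store
  have "halts (split_vset k) s (N * (1 + expr_cost (Var k) + 20) + (1 + expr_cost (Var k))) (I N)"
    unfolding split_vset_def
  proof (rule halts_For)
    fix j s' assume j: "j < N" and I: "I j s'"
    then obtain m where m: "N - j = Suc m" "N - Suc j = m" by (metis Suc_diff_Suc)
    then have "[m..<N] = m # [N - j..<N]" using j by (simp add: upt_conv_Cons)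
    then show "eval_expr (Var k) s' \<noteq> Atom \<and> halts (seq [
     Assign (k + 1) (PairE (LeftE (Var k)) (Var (k + 1))),
     Assign k (RightE (RightE (Var k)))]) s' 20 (I (Suc j))"
      using I m by (auto simp: I_def halts_simps)
  qed (use assms in \<open>auto simp: I_def\<close>)
  then show ?thesis by (rule halts_mono) (auto simp: I_def)
qed

lemma enc_vset_double:
  assumes "card (pverts H) = 2 * N"
  shows "enc_vset H J
    = enc_list (pairs (\<lambda>i. enc_bool (copyA N i \<in> J)) (\<lambda>i. enc_bool (copyB N i \<in> J)) N)"
proof -
  have "enc_bool (k \<in> J) = (if even k then enc_bool (copyA N (origin N k) \<in> J)
    else enc_bool (copyB N (origin N k) \<in> J))" if "k < 2 * N" for k
    using that by (cases rule: copy_cases) auto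
  then show ?thesis unfolding enc_vset_def assms pairs_eq_map
    by (intro arg_cong[of _ _ enc_list] map_cong) auto
qed

lemma halts_post_body:
  assumes k: "0 < k" and s: "s 0 = Dot (enc_vset (reduct G) J) rest"
  shows "halts (post_body k) s ((card (pverts G) + 2) * 22 + 50) (\<lambda>s'. s' 0 = rest \<and>
    s' (k + 2) = (if selected G J then Dot (enc_vset G (decode G J)) (s (k + 2)) else s (k + 2)))"
proof -
  define n where "n = card (pverts G)"
  define N where "N = n + 2"
  define f where "f = (\<lambda>i. enc_bool (copyA N i \<in> J))"
  define g where "g = (\<lambda>i. enc_bool (copyB N i \<in> J))"
  let ?s = "s(k := enc_vset (reduct G) J, 0 := rest, k + 1 := Atom)"
  have split: "halts (split_vset k) ?s (N * 22 + 2) (\<lambda>s'. s' (k + 1) = enc_list (map f [0..<N]) \<and>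
    (\<forall>x. x \<noteq> k \<and> x \<noteq> k + 1 \<longrightarrow> s' x = ?s x))"
    by (rule halts_split_vset[where g = g])
      (use enc_vset_double[of "reduct G" N J, folded f_def g_def] k in
        \<open>simp_all add: card_reduct N_def n_def del: pairs.simps\<close>)
  have upt: "[0..<N] = 0 # 1 # map (\<lambda>v. v + 2) [0..<n]"
    by (simp add: N_def upt_conv_Cons map_Suc_upt[symmetric] comp_def del: upt_Suc)
  have dec: "enc_list (map (\<lambda>v. f (v + 2)) [0..<n]) = enc_vset G (decode G J)"
    unfolding enc_vset_def n_def[symmetric]
    by (auto simp: f_def decode_def Let_def N_def n_def intro!: arg_cong[of _ _ enc_list])
  have sel: "selected G J \<longleftrightarrow> f 0 \<noteq> Atom \<and> f 1 \<noteq> Atom"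
    by (simp add: selected_def Let_def f_def N_def n_def)
  have test: "halts (post_test k) s' 30 (\<lambda>s'. s' 0 = rest \<and>
    s' (k + 2) = (if selected G J then Dot (enc_vset G (decode G J)) (s (k + 2)) else s (k + 2)))"
    if s': "s' (k + 1) = enc_list (map f [0..<N])" "s' 0 = rest" "s' (k + 2) = s (k + 2)" for s'
    unfolding post_test_def
    by (rule halts_Cond, simp)
      (use s' k in \<open>auto simp: upt sel halts_simps comp_def dec[symmetric] split: if_splits intro!: halts_Cond\<close>)
  have "halts (Seq (split_vset k) (seq [post_test k])) ?s (N * 22 + 35) (\<lambda>s'. s' 0 = rest \<and>
    s' (k + 2) = (if selected G J then Dot (enc_vset G (decode G J)) (s (k + 2)) else s (k + 2)))"
    unfolding seq.simps
    by (rule halts_SeqI[OF split], simp, rule halts_SeqI[OF test]) (use k in \<open>auto simp: halts_simps\<close>)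
  then show ?thesis
    unfolding post_body_def
    by (simp add: halts_simps s N_def n_def) (use k in \<open>auto elim!: halts_mono\<close>)
qed

text \<open>One pass over the list; results are prepended, whence the \<open>rev\<close>.\<close>

lemma halts_post:
  assumes k: "0 < k" and s: "s 0 = enc_list (map (enc_vset (reduct G)) Js)"
  shows "halts (post k) s (length Js * ((card (pverts G) + 2) * 22 + 52) + 10)
    (\<lambda>s'. s' 0 = enc_list (map (enc_vset G) (rev (map (decode G) (filter (selected G) Js)))))"
proof -
  define T where "T = (card (pverts G) + 2) * 22 + 50"
  define I where "I j s' \<longleftrightarrow> s' 0 = enc_list (map (enc_vset (reduct G)) (drop j Js)) \<and>
    s' (k + 2) = enc_list (map (enc_vset G) (rev (map (decode G) (filter (selected G) (take j Js)))))"
    for j :: nat and s' :: store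
  have loop: "halts (While (Var 0) (post_body k)) s'
    (length Js * (1 + expr_cost (Var 0) + T) + (1 + expr_cost (Var 0))) (I (length Js))"
    if init: "I 0 s'" for s'
  proof (rule halts_For)
    fix j s' assume j: "j < length Js" and I: "I j s'"
    then have d: "drop j Js = Js ! j # drop (Suc j) Js" by (simp add: Cons_nth_drop_Suc)
    then have "halts (post_body k) s' T (\<lambda>s''.
        s'' 0 = enc_list (map (enc_vset (reduct G)) (drop (Suc j) Js)) \<and>
        s'' (k + 2) = (if selected G (Js ! j) then Dot (enc_vset G (decode G (Js ! j))) (s' (k + 2)) else s' (k + 2)))"
      unfolding T_def using I by (intro halts_post_body[OF k]) (simp add: I_def)
    then have "halts (post_body k) s' T (I (Suc j))"
      by (rule halts_mono) (use I j in \<open>auto simp: I_def take_Suc_conv_app_nth\<close>)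
    then show "eval_expr (Var 0) s' \<noteq> Atom \<and> halts (post_body k) s' T (I (Suc j))"
      using I d by (auto simp: I_def)
  qed (use init in \<open>auto simp: I_def\<close>)
  have "halts (Seq (While (Var 0) (post_body k)) (seq [Assign 0 (Var (k + 2))])) (s(k + 2 := Atom))
    (length Js * (T + 2) + 8)
    (\<lambda>s'. s' 0 = enc_list (map (enc_vset G) (rev (map (decode G) (filter (selected G) Js)))))"
    by (rule halts_SeqI[OF loop]) (use s k in \<open>auto simp: I_def halts_simps\<close>)
  then show ?thesis
    unfolding post_def seq.simps T_def
    by (simp add: halts_simps ac_simps)
qed

section \<open>Sizes and running times\<close>

lemma size_enc_list: "size (enc_list xs) = sum_list (map size xs) + length xs"
  by (induction xs) auto

lemma size_enc_list_le: "(\<And>x. x \<in> set xs \<Longrightarrow> size x \<le> B) \<Longrightarrow> size (enc_list xs) \<le> length xs * (B + 1)"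
proof (induction xs)
  case (Cons x xs)
  then have "size x \<le> B" "size (enc_list xs) \<le> length xs * (B + 1)" by auto
  then show ?case by simp
qed simp

lemma size_enc_bools: "size (enc_list (map (\<lambda>x. enc_bool (P x)) xs)) \<le> 2 * length xs"
  by (induction xs) (auto simp: enc_bool_def)

lemma size_enc_graph_le:
  "size (enc_graph G) \<le> card (pverts G) * (2 * card (pverts G) + 1)"
  unfolding enc_graph_def Let_def
  by (rule order_trans[OF size_enc_list_le[where B = "2 * card (pverts G)"]])
    (auto intro: order_trans[OF size_enc_bools])

lemma size_enc_vset_le: "size (enc_vset G I) \<le> 2 * card (pverts G)"
  unfolding enc_vset_def by (rule order_trans[OF size_enc_bools]) simp

text \<open>The matrix has one list cell per row, so the number of vertices is bounded by the input
  size.\<close>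

lemma card_pverts_le_size: "card (pverts G) \<le> size (enc_graph G)"
  by (simp add: enc_graph_def Let_def size_enc_list)

text \<open>Coefficients are natural numbers, so sizes may be replaced by upper bounds inside a
  polynomial.\<close>

lemma poly_nat_mono: "x \<le> y \<Longrightarrow> poly p x \<le> poly p y" for p :: "nat poly"
  by (induction p) (auto simp: add_mono mult_mono)

theorem theorem3:
  shows "(\<exists>c. solves_GraphMirr_Enum c input_graphs \<and> output_polynomial_time c input_graphs) \<longleftrightarrow>
    (\<exists>c. solves_GraphMirr_Enum c {G \<in> input_graphs. co_bipartite G} \<and>
         output_polynomial_time c {G \<in> input_graphs. co_bipartite G})"
proof
  assume "\<exists>c. solves_GraphMirr_Enum c input_graphs \<and> output_polynomial_time c input_graphs"
  \<comment> \<open>Co-bipartite inputs form a subset of all inputs, so the same program and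
    polynomial serve.\<close>
  then show "\<exists>c. solves_GraphMirr_Enum c {G \<in> input_graphs. co_bipartite G} \<and>
         output_polynomial_time c {G \<in> input_graphs. co_bipartite G}"
    unfolding solves_GraphMirr_Enum_def output_polynomial_time_def by blast
next
  assume "\<exists>c. solves_GraphMirr_Enum c {G \<in> input_graphs. co_bipartite G} \<and>
         output_polynomial_time c {G \<in> input_graphs. co_bipartite G}"
  then obtain c p where c: "solves_GraphMirr_Enum c {G \<in> input_graphs. co_bipartite G}"
    and p: "\<forall>G\<in>{G \<in> input_graphs. co_bipartite G}. \<exists>t out. computes c (enc_graph G) t out \<and>
        t \<le> poly p (size (enc_graph G) + size out)"
    unfolding output_polynomial_time_def by blast
  \<comment> \<open>Work variables start above every variable of \<open>c\<close>; the successor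
    also keeps them apart from variable 0.\<close>
  define k where "k = Suc (var_bound c)"
  define c' where "c' = seq [prep k, c, post k]"
  \<comment> \<open>All are polynomials in the size \<open>m\<close> of input plus output for
    \<open>G\<close>: \<open>N\<close> bounds the vertices of the extended graph, \<open>L\<close>
    the number of sets listed for \<open>reduct G\<close>, \<open>S\<close> the combined size of its
    encoding and output, and \<open>q\<close> the total time.\<close>
  define N :: "nat poly" where "N = [:2, 1:]"
  define L :: "nat poly" where "L = 2 * [:0, 1:] + N * N"
  define S :: "nat poly" where "S = 2 * N * (4 * N + 1) + L * (4 * N + 1)"
  define q where "q = (N * (N * 82 + 100) + 100) + pcompose p S + (L * (N * 22 + 52) + 20)"
  have main: "\<exists>t Is. computes c' (enc_graph G) t (enc_list (map (enc_vset G) Is)) \<and>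
      distinct Is \<and> set Is = MaxIrr G \<and>
      t \<le> poly q (size (enc_graph G) + size (enc_list (map (enc_vset G) Is)))"
    if G: "G \<in> input_graphs" for G
  proof -
    let ?H = "reduct G"
    obtain t Js where Js: "computes c (enc_graph ?H) t (enc_list (map (enc_vset ?H) Js))"
      "distinct Js" "set Js = MaxIrr ?H"
      using c reduct_cobipartite[OF G] unfolding solves_GraphMirr_Enum_def by blast
    let ?out = "enc_list (map (enc_vset ?H) Js)"
    \<comment> \<open>Determinism transfers the time bound to the run that was obtained from
      correctness.\<close>
    have t: "t \<le> poly p (size (enc_graph ?H) + size ?out)"
      using p reduct_cobipartite[OF G] computes_deterministic[OF Js(1)] by blast
    define Is where "Is = rev (map (decode G) (filter (selected G) Js))"
    have set: "set (filter (selected G) Js) = {J \<in> MaxIrr ?H. selected G J}" using Js by auto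
    have dist: "distinct Is"
      using decode_reduct(2)[OF G] Js(2) set unfolding Is_def by (simp add: distinct_map)
    have setIs: "set Is = MaxIrr G"
      using decode_reduct(1)[OF G] set unfolding Is_def by simp
    define n where "n = card (pverts G)"
    define m where "m = size (enc_graph G) + size (enc_list (map (enc_vset G) Is))"
    have "n \<le> m" unfolding n_def m_def using card_pverts_le_size[of G] by linarith
    then have n: "n + 2 \<le> poly N m" by (simp add: N_def)
    \<comment> \<open>Each listed set takes at least one cell of the output, so the number of sets
      is at most \<open>m\<close>.\<close>
    have "card (MaxIrr G) = length Is" using dist setIs distinct_card by metis
    then have card: "card (MaxIrr G) \<le> m" by (simp add: m_def size_enc_list)
    have "length Js = card (MaxIrr ?H)" using Js distinct_card by metis
    also have "\<dots> \<le> 2 * card (MaxIrr G) + (n + 2) * (n + 2)"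
      using card_MaxIrr_reduct[OF G] by (simp add: n_def power2_eq_square)
    also have "\<dots> \<le> 2 * m + poly N m * poly N m" by (intro add_mono mult_mono card n) auto
    finally have len: "length Js \<le> poly L m" by (simp add: L_def)
    have "size (enc_graph ?H) \<le> 2 * (n + 2) * (4 * (n + 2) + 1)"
      using size_enc_graph_le[of ?H] by (simp add: card_reduct n_def algebra_simps)
    also have "\<dots> \<le> 2 * poly N m * (4 * poly N m + 1)" by (intro add_mono mult_mono n) auto
    finally have sizeH: "size (enc_graph ?H) \<le> 2 * poly N m * (4 * poly N m + 1)" .
    have "size (enc_vset ?H J) \<le> 4 * (n + 2)" for J
      using size_enc_vset_le[of ?H J] by (simp add: card_reduct n_def)
    then have "size ?out \<le> length Js * (4 * (n + 2) + 1)"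
      using size_enc_list_le[of "map (enc_vset ?H) Js" "4 * (n + 2)"] by auto
    also have "\<dots> \<le> poly L m * (4 * poly N m + 1)" by (intro add_mono mult_mono n len) auto
    finally have "size (enc_graph ?H) + size ?out \<le> poly S m" using sizeH by (simp add: S_def)
    then have t': "t \<le> poly p (poly S m)" using t poly_nat_mono le_trans by blast

    have k: "0 < k" by (simp add: k_def)
    have run_c: "halts c s (poly p (poly S m)) (\<lambda>s'. s' 0 = ?out)"
      if s: "s 0 = enc_graph ?H" "\<forall>x. 0 < x \<and> x < k \<longrightarrow> s x = Atom" for s
    proof -
      obtain s1 where s1: "exec c ((\<lambda>_. Atom)(0 := enc_graph ?H)) t s1" "s1 0 = ?out"
        using Js(1) by (auto simp: computes_def)
      \<comment> \<open>Below \<open>k\<close> the store left by the preprocessing agrees with the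
        initial store of a fresh run of \<open>c\<close>.\<close>
      have "\<forall>x<k. ((\<lambda>_. Atom)(0 := enc_graph ?H)) x = s x" using s by auto
      from exec_frame[OF s1(1) _ this] obtain s' where "exec c s t s'" "\<forall>x<k. s1 x = s' x"
        by (auto simp: k_def)
      then show ?thesis unfolding halts_def using s1(2) k t' by metis
    qed
    let ?T = "poly p (poly S m)"
    have "halts (Seq c (Seq (post k) Skip)) s (?T + (poly L m * (poly N m * 22 + 52) + 20))
      (\<lambda>s'. s' 0 = enc_list (map (enc_vset G) Is))"
      if s: "s 0 = enc_graph ?H" "\<forall>x. 0 < x \<and> x < k \<longrightarrow> s x = Atom" for s
    proof (rule halts_SeqI[OF run_c[OF s]])
      fix s' :: store assume s': "s' 0 = ?out"
      have "length Js * ((card (pverts G) + 2) * 22 + 52) + 10 \<le> poly L m * (poly N m * 22 + 52) + 10"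
        by (intro add_mono mult_mono len n[unfolded n_def]) auto
      then have "halts (Seq (post k) Skip) s' (poly L m * (poly N m * 22 + 52) + 20)
        (\<lambda>s'. s' 0 = enc_list (map (enc_vset G) Is))"
        by (intro halts_SeqI[OF halts_post[where s = s', OF k s']]) (auto simp: halts_simps Is_def)
      then show "halts (Seq (post k) Skip) s' (?T + (poly L m * (poly N m * 22 + 52) + 20) - ?T)
        (\<lambda>s'. s' 0 = enc_list (map (enc_vset G) Is))" by simp
    qed simp
    note rest = this
    have "(n + 2) * ((n + 2) * 82 + 100) + 100 \<le> poly N m * (poly N m * 82 + 100) + 100"
      by (intro add_mono mult_mono n) auto
    then have prep: "halts (prep k) ((\<lambda>_. Atom)(0 := enc_graph G)) (poly N m * (poly N m * 82 + 100) + 100)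
      (\<lambda>s'. s' 0 = enc_graph ?H \<and> (\<forall>x. 0 < x \<and> x < k \<longrightarrow> s' x = Atom))"
      by (intro halts_mono[OF halts_prep[OF k]]) (auto simp: n_def)
    \<comment> \<open>The three budgets add up to \<open>q\<close>; the final \<open>Skip\<close> in
      \<open>seq\<close> is paid from the slack in the postprocessing budget.\<close>
    have "halts c' ((\<lambda>_. Atom)(0 := enc_graph G)) (poly q m) (\<lambda>s'. s' 0 = enc_list (map (enc_vset G) Is))"
      unfolding c'_def seq.simps
      by (rule halts_mono[OF halts_Seq[OF halts_mono[OF prep order_refl rest]]])
        (auto simp: q_def poly_pcompose)
    then show ?thesis
      unfolding halts_def computes_def using dist setIs m_def by metis
  qed
  then have "solves_GraphMirr_Enum c' input_graphs"
    unfolding solves_GraphMirr_Enum_def by blast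
  moreover have "output_polynomial_time c' input_graphs"
    using main unfolding output_polynomial_time_def by blast
  ultimately show "\<exists>c. solves_GraphMirr_Enum c input_graphs \<and> output_polynomial_time c input_graphs"
    by blast
qed

end
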